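(* Let $m,n \geq k \geq 1$ be integers. Given $A \in \mathbb{R}^{m \times n}$, the following statements are equivalent. (i) The matrix $A$ is totally positive of order $k$. (ii) For every $r \in \{1,\ldots,k\}$ and every contiguous $r\times r$ submatrix $A_r$ of $A$, defining the vectors $$x^{A_r} := (A^{11}_r,0,A^{13}_r,0,\ldots)^T\in\mathbb{R}^r, \qquad q^{A_r} :=-A_r x^{A_r},$$ the vector $x^{A_r}$ is the only solution of $\mathrm{LCP}(A_r,q^{A_r})$ (in particular, it is a solution).
   Context: A real matrix is totally positive of order $k$ ($TP_k$) if all its minors of order at most $k$ are positive. A contiguous submatrix is one whose row index set and column index set are each sets of consecutive integers. For an $r\times r$ matrix $A_r$, $A_r^{ij}$ denotes the determinant of the $(r-1)\times(r-1)$ submatrix of $A_r$ obtained by deleting row $i$ and column $j$; if $r=1$, $A_1^{11}:=1$ (the determinant of the empty matrix). Thus the $j$-th coordinate of $x^{A_r}$ is $A_r^{1j}$ for $j$ odd and $0$ for $j$ even. For $M\in\mathbb{R}^{r\times r}$ and $q\in\mathbb{R}^r$, the Linear Complementarity Problem $\mathrm{LCP}(M,q)$ asks for $x\in\mathbb{R}^r$ with $x\ge 0$, $y=Mx+q\ge 0$ (coordinatewise) and $x^Ty=0$; any such $x$ is called a solution. *)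

theory Defs
  imports
    Complex_Main
    "Jordan_Normal_Form.Determinant"
    "Jordan_Normal_Form.DL_Submatrix"
begin

text \<open>
  Matrices and vectors are those of the Jordan normal form library; they carry their dimensions
  and are indexed from \<open>0\<close>. Vectors are ordered coordinatewise (and only if the dimensions agree).
\<close>

definition TP :: "nat \<Rightarrow> real mat \<Rightarrow> bool" where
  "TP k A \<longleftrightarrow>
     (\<forall>r I J. 1 \<le> r \<and> r \<le> k \<and>
        I \<subseteq> {..<dim_row A} \<and> J \<subseteq> {..<dim_col A} \<and> card I = r \<and> card J = r \<longrightarrow>
        0 < det (submatrix A I J))"

definition consecutive :: "nat set \<Rightarrow> bool" where
  "consecutive I \<longleftrightarrow> (\<exists>a b. I = {a..<b})"

definition contiguous_submatrix :: "'a mat \<Rightarrow> nat \<Rightarrow> 'a mat \<Rightarrow> bool" where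
  "contiguous_submatrix A r B \<longleftrightarrow>
     (\<exists>I J. I \<subseteq> {..<dim_row A} \<and> J \<subseteq> {..<dim_col A} \<and>
        consecutive I \<and> consecutive J \<and> card I = r \<and> card J = r \<and> B = submatrix A I J)"

definition LCP_solutions :: "real mat \<Rightarrow> real vec \<Rightarrow> real vec set" where
  "LCP_solutions M q =
     {x \<in> carrier_vec (dim_col M).
        0\<^sub>v (dim_col M) \<le> x \<and> 0\<^sub>v (dim_row M) \<le> M *\<^sub>v x + q \<and> x \<bullet> (M *\<^sub>v x + q) = 0}"

text \<open>
  With 0-based indices, the odd positions \<open>1, 3, \<dots>\<close> of \<open>x\<^sup>A = (A\<^sup>1\<^sup>1, 0, A\<^sup>1\<^sup>3, 0, \<dots>)\<close> become the
  even \<open>j\<close>, and the first row has index \<open>0\<close>. The minors are unsigned (not cofactors). For a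
  \<open>1 \<times> 1\<close> matrix, the only minor is the determinant of the empty matrix, which is \<open>1\<close>.
\<close>

definition x_vec :: "real mat \<Rightarrow> real vec" where
  "x_vec A = vec (dim_col A) (\<lambda>j. if even j then det (mat_delete A 0 j) else 0)"

definition q_vec :: "real mat \<Rightarrow> real vec" where
  "q_vec A = - (A *\<^sub>v x_vec A)"

end

theory Submission
  imports Defs
begin

text \<open>
  A matrix with positive principal minors never reverses the signs of a nonzero vector, so each of
  its linear complementarity problems has at most one solution; for totally positive blocks \<open>B\<close>,
  \<open>x\<^sup>B\<close> is a solution because \<open>B x\<^sup>B + q\<^sup>B = 0\<close>. Conversely, by Fekete's criterion only
  contiguous minors matter. Inductively all minors of \<open>B\<close> of smaller order are positive, and if
  \<open>det B \<le> 0\<close> then \<open>(0, B\<^sup>1\<^sup>2, 0, B\<^sup>1\<^sup>4, \<dots>)\<close> is a second solution.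
\<close>

section \<open>Minors indexed by functions\<close>

text \<open>Index functions instead of index sets let rows repeat, and they turn the deletion of a
  row or column into composition with \<open>insert_index\<close>.\<close>

definition minor :: "(nat \<Rightarrow> nat \<Rightarrow> 'a::comm_ring_1) \<Rightarrow> (nat \<Rightarrow> nat) \<Rightarrow> (nat \<Rightarrow> nat) \<Rightarrow> nat \<Rightarrow> 'a" where
  "minor c f g r = det (mat r r (\<lambda>(i, j). c (f i) (g j)))"

lemma minor_0 [simp]: "minor c f g 0 = 1"
  by (simp add: minor_def)

lemma minor_cong:
  assumes "\<And>i j. i < r \<Longrightarrow> j < r \<Longrightarrow> c (f i) (g j) = c' (f' i) (g' j)"
  shows "minor c f g r = minor c' f' g' r"
  unfolding minor_def by (rule arg_cong[of _ _ det], rule cong_mat) (use assms in auto)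

lemma minor_transpose: "minor (\<lambda>i j. c j i) g f r = minor c f g r"
proof -
  have "mat r r (\<lambda>(i, j). c (f j) (g i)) = transpose_mat (mat r r (\<lambda>(i, j). c (f i) (g j)))"
    by (rule eq_matI) auto
  then show ?thesis
    unfolding minor_def using det_transpose[of "mat r r (\<lambda>(i, j). c (f i) (g j))" r] by simp
qed

lemma strict_mono_insert_index: "strict_mono (insert_index a)"
  by (auto simp: strict_mono_def insert_index_def)

lemma insert_index_less: "i < n \<Longrightarrow> insert_index a i < Suc n"
  by (simp add: insert_index_def)

lemma minor_laplace_row:
  assumes "a < Suc r"
  shows "minor c f g (Suc r) =
    (\<Sum>j<Suc r. c (f a) (g j) * ((-1) ^ (a + j) * minor c (f \<circ> insert_index a) (g \<circ> insert_index j) r))"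
proof -
  let ?A = "mat (Suc r) (Suc r) (\<lambda>(i, j). c (f i) (g j))"
  have "mat_delete ?A a j = mat r r (\<lambda>(i, j'). c ((f \<circ> insert_index a) i) ((g \<circ> insert_index j) j'))"
    if "j < Suc r" for j
    unfolding mat_delete_def by (rule eq_matI) (use assms that in \<open>auto simp: insert_index_def\<close>)
  then show ?thesis
    using laplace_expansion_row[of ?A "Suc r" a] assms
    by (simp add: minor_def cofactor_def del: sum.lessThan_Suc)
qed

lemma minor_identical_rows:
  assumes "i \<noteq> i'" "i < r" "i' < r" "f i = f i'"
  shows "minor c f g r = 0"
  unfolding minor_def
  by (rule det_identical_rows[of _ r i i']) (use assms in \<open>auto intro!: eq_vecI\<close>)

text \<open>Laplace expansion of a determinant whose first row repeats row \<open>i\<close>.\<close>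

lemma minor_kernel_row:
  assumes "i < n"
  shows "(\<Sum>q<Suc n. c (f i) (g q) * ((-1) ^ q * minor c f (g \<circ> insert_index q) n)) = 0"
proof -
  define F where "F = case_nat (f i) f"
  have F: "F \<circ> insert_index 0 = f" "F 0 = f i"
    by (auto simp: F_def insert_index_def)
  have "minor c F g (Suc n) = 0"
    by (rule minor_identical_rows[of 0 "Suc i"]) (use assms in \<open>auto simp: F_def\<close>)
  then show ?thesis
    using minor_laplace_row[of 0 n c F g] F by simp
qed

text \<open>By transposition, the signed maximal minors of \<open>n + 1\<close> rows and
  \<open>n\<close> columns form a left kernel vector; the Pluecker relation below rests on
  it.\<close>

lemma minor_kernel_col:
  assumes "j < n"
  shows "(\<Sum>p<Suc n. c (f p) (g j) * ((-1) ^ p * minor c (f \<circ> insert_index p) g n)) = 0"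
  using minor_kernel_row[OF assms, of "\<lambda>i j. c j i" g f] by (simp only: minor_transpose[of c])

text \<open>Laplace expansion along row \<open>a\<close>: the remaining minors avoid that row and so
  agree for all three entry functions.\<close>

lemma minor_row_linear:
  assumes "a < r"
    and "\<And>i j. i < r \<Longrightarrow> i \<noteq> a \<Longrightarrow> c1 (f i) j = c (f i) j"
    and "\<And>i j. i < r \<Longrightarrow> i \<noteq> a \<Longrightarrow> c2 (f i) j = c (f i) j"
    and "\<And>j. c (f a) j = \<alpha> * c1 (f a) j + \<beta> * c2 (f a) j"
  shows "minor c f g r = \<alpha> * minor c1 f g r + \<beta> * minor c2 f g r"
proof (cases r)
  case 0
  with assms(1) show ?thesis by simp
next
  case (Suc n)
  have 1: "minor c1 (f \<circ> insert_index a) h n = minor c (f \<circ> insert_index a) h n"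
      and 2: "minor c2 (f \<circ> insert_index a) h n = minor c (f \<circ> insert_index a) h n" for h
    by (auto intro!: minor_cong assms(2,3) simp: Suc insert_index_less)
  show ?thesis
    unfolding Suc using assms(1)
    by (simp add: minor_laplace_row[of a] Suc 1 2 assms(4) sum_distrib_left sum.distrib[symmetric]
        algebra_simps del: sum.lessThan_Suc)
qed

section \<open>Fekete's criterion\<close>

text \<open>A three-term Pluecker relation: pairing the left kernel vector of the \<open>s + 3\<close> rows with the
  linear form that takes a row \<open>v\<close> to the minor on \<open>v\<close> and the \<open>s\<close> rows other than
  \<open>0\<close>, \<open>l\<close>, \<open>s + 2\<close>.\<close>

lemma minor_three_term:
  assumes "0 < l" "l < Suc (Suc s)"
  shows "minor c (h \<circ> insert_index l) g (Suc (Suc s)) * minor c (h \<circ> Suc) g (Suc s) =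
    minor c (h \<circ> Suc) g (Suc (Suc s)) * minor c (h \<circ> insert_index l) g (Suc s) +
    minor c h g (Suc (Suc s)) * minor c (h \<circ> Suc \<circ> insert_index (l - 1)) g (Suc s)"
proof -
  define \<rho> where "\<rho> = h \<circ> Suc \<circ> insert_index (l - 1)"
  define \<phi> where "\<phi> v = (\<Sum>j<Suc s. c v (g j) * ((-1) ^ j * minor c \<rho> (g \<circ> insert_index j) s))" for v
  define D where "D p = minor c (h \<circ> insert_index p) g (Suc (Suc s))" for p
  \<comment> \<open>A minor of order \<open>s + 1\<close> whose rows are those of \<rho> and one
    more at position \<open>a\<close> is a signed value of \<phi>; the factors of order
    \<open>s + 1\<close> in the claim that involve row \<open>0\<close>, \<open>l\<close> or
    \<open>s + 2\<close> all have this form.\<close>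
  have expand: "minor c f g (Suc s) = (-1) ^ a * \<phi> (f a)"
    if "a < Suc s" "\<And>i. i < s \<Longrightarrow> f (insert_index a i) = \<rho> i" for f a
  proof -
    have "minor c (f \<circ> insert_index a) k s = minor c \<rho> k s" for k
      by (rule minor_cong) (simp add: that)
    then show ?thesis
      unfolding minor_laplace_row[OF that(1)] \<phi>_def
      by (simp add: sum_distrib_left power_add algebra_simps del: sum.lessThan_Suc)
  qed
  have \<phi>0: "\<phi> (\<rho> i) = 0" if "i < s" for i
    unfolding \<phi>_def using that by (rule minor_kernel_row)
  have e1: "minor c (h \<circ> insert_index l) g (Suc s) = \<phi> (h 0)"
    using expand[of 0 "h \<circ> insert_index l"] assms by (cases l) (auto simp: \<rho>_def insert_index_def)
  have e2: "minor c (h \<circ> Suc) g (Suc s) = (-1) ^ (l - 1) * \<phi> (h l)"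
    using expand[of "l - 1" "h \<circ> Suc"] assms by (auto simp: \<rho>_def)
  have e3: "minor c \<rho> g (Suc s) = (-1) ^ s * \<phi> (h (Suc (Suc s)))"
    using expand[of s \<rho>] assms by (auto simp: \<rho>_def insert_index_def)
  \<comment> \<open>The signed \<open>D\<close> annihilates every column \<open>g j\<close>, so its
    pairing with \<phi> is zero; \<phi> in turn vanishes on the rows of \<rho>, which leaves three
    terms.\<close>
  have "(\<Sum>p<Suc (Suc (Suc s)). (-1) ^ p * D p * \<phi> (h p)) =
      (\<Sum>j<Suc s. (\<Sum>p<Suc (Suc (Suc s)). c (h p) (g j) * ((-1) ^ p * D p)) *
        ((-1) ^ j * minor c \<rho> (g \<circ> insert_index j) s))"
    unfolding \<phi>_def sum_distrib_left sum_distrib_right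
    by (subst sum.swap) (simp add: algebra_simps del: sum.lessThan_Suc)
  also have "\<dots> = 0"
    unfolding D_def by (rule sum.neutral) (simp add: minor_kernel_col del: sum.lessThan_Suc)
  also have "(\<Sum>p<Suc (Suc (Suc s)). (-1) ^ p * D p * \<phi> (h p)) =
      (\<Sum>p\<in>{0, l, Suc (Suc s)}. (-1) ^ p * D p * \<phi> (h p))"
  proof (rule sum.mono_neutral_right)
    show "\<forall>p\<in>{..<Suc (Suc (Suc s))} - {0, l, Suc (Suc s)}. (-1) ^ p * D p * \<phi> (h p) = 0"
    proof
      fix p assume p: "p \<in> {..<Suc (Suc (Suc s))} - {0, l, Suc (Suc s)}"
      \<comment> \<open>The position of row \<open>p\<close> in \<rho>, which skips the rows
        \<open>0\<close> and \<open>l\<close>.\<close>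
      define i where "i = (if p < l then p - 1 else p - 2)"
      have "i < s" "\<rho> i = h p"
        using p assms by (auto simp: i_def \<rho>_def insert_index_def intro!: arg_cong[of _ _ h])
      with \<phi>0[of i] show "(-1) ^ p * D p * \<phi> (h p) = 0" by simp
    qed
  qed (use assms in auto)
  also have "\<dots> = D 0 * \<phi> (h 0) + (-1) ^ l * D l * \<phi> (h l) + (-1) ^ s * D (Suc (Suc s)) * \<phi> (h (Suc (Suc s)))"
    using assms by (simp add: add.assoc)
  also have "(-1) ^ l = - ((-1) ^ (l - 1) :: 'a)"
    using assms by (cases l) auto
  finally have *: "(-1) ^ (l - 1) * D l * \<phi> (h l) = D 0 * \<phi> (h 0) + (-1) ^ s * D (Suc (Suc s)) * \<phi> (h (Suc (Suc s)))"
    by (simp add: algebra_simps add_eq_0_iff)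
  have "D 0 = minor c (h \<circ> Suc) g (Suc (Suc s))" "D (Suc (Suc s)) = minor c h g (Suc (Suc s))"
    unfolding D_def by (auto intro!: minor_cong)
  with * show ?thesis
    unfolding \<rho>_def[symmetric] e1 e2 e3 D_def[symmetric] by (simp add: algebra_simps)
qed

lemma strict_mono_on_gap:
  fixes f :: "nat \<Rightarrow> nat"
  assumes "strict_mono_on {..<r} f" "i < r" "\<And>l. 0 < l \<Longrightarrow> l < r \<Longrightarrow> \<not> f (l - 1) + 1 < f l"
  shows "f i = f 0 + i"
  using assms(2)
proof (induction i)
  case (Suc i)
  have "f i < f (Suc i)"
    using assms(1) Suc.prems by (auto simp: strict_mono_on_def)
  with assms(3)[of "Suc i"] Suc show ?case by auto
qed simp

text \<open>Induction on the dispersion \<open>f (r - 1) - f 0\<close>: a row inserted into a gap of \<open>f\<close> expresses the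
  minor through two minors of smaller dispersion.\<close>

lemma minor_pos_of_consecutive_rows:
  fixes c :: "nat \<Rightarrow> nat \<Rightarrow> 'a::linordered_idom"
  assumes lower: "\<And>f. strict_mono_on {..<r - 1} f \<Longrightarrow> f ` {..<r - 1} \<subseteq> {..<m} \<Longrightarrow> 0 < minor c f g (r - 1)"
    and consec: "\<And>a. a + r \<le> m \<Longrightarrow> 0 < minor c (\<lambda>i. a + i) g r"
    and f: "strict_mono_on {..<r} f" "f ` {..<r} \<subseteq> {..<m}"
  shows "0 < minor c f g r"
  using f
proof (induction "f (r - 1) - f 0" arbitrary: f rule: less_induct)
  case (less f)
  note mono = strict_mono_onD[OF less.prems(1)]
  show ?case
  proof (cases "\<exists>l. 0 < l \<and> l < r \<and> f (l - 1) + 1 < f l")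
    case False
    then have eq: "f i = f 0 + i" if "i < r" for i
      using strict_mono_on_gap[OF less.prems(1) that] by blast
    have "f 0 + r \<le> m" if "0 < r"
    proof -
      have "f (r - 1) < m" using less.prems(2) that by (simp add: image_subset_iff)
      with eq[of "r - 1"] that show ?thesis by simp
    qed
    moreover have "minor c f g r = minor c (\<lambda>i. f 0 + i) g r"
      by (rule minor_cong) (simp only: eq[symmetric])
    ultimately show ?thesis
      using consec[of "f 0"] by (cases "r = 0") auto
  next
    case True
    then obtain l where l: "0 < l" "l < r" "f (l - 1) + 1 < f l" by blast
    then obtain s where r: "r = Suc (Suc s)"
      by (cases r; cases "r - 1") auto
    \<comment> \<open>The missing row \<open>f (l - 1) + 1\<close> enters at position
      \<open>l\<close>; deleting it with \<open>insert_index l\<close> returns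
      \<open>f\<close>.\<close>
    define h where "h i = (if i < l then f i else if i = l then f (l - 1) + 1 else f (i - 1))" for i
    have h_less: "h i < h j" if ij: "i < j" "j < Suc r" for i j
    proof -
      have le: "f a \<le> f b" if "a \<le> b" "b < r" for a b
        using mono[of a b] that by (cases "a = b") auto
      consider "j < l" | "i < l" "j = l" | "i < l" "l < j" | "i = l" "l < j" | "l < i" "l < j"
        using ij by (cases i l rule: linorder_cases; cases j l rule: linorder_cases) auto
      then show ?thesis
      proof cases
        case 1
        with ij l mono[of i j] show ?thesis by (simp add: h_def)
      next
        case 2
        then have "f i \<le> f (l - 1)" using l by (intro le) auto
        with 2 show ?thesis by (simp add: h_def)
      next
        case 3
        with ij l mono[of i "j - 1"] show ?thesis by (simp add: h_def)
      next
        case 4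
        then have "f l \<le> f (j - 1)" using ij by (intro le) auto
        with 4 l show ?thesis by (simp add: h_def)
      next
        case 5
        then have "f (i - 1) < f (j - 1)" using ij by (intro mono) auto
        with 5 show ?thesis by (simp add: h_def)
      qed
    qed
    have h_m: "h i < m" if "i < Suc r" for i
    proof -
      have fm: "f i < m" if "i < r" for i using less.prems(2) that by auto
      show ?thesis using that l fm[of i] fm[of l] fm[of "i - 1"] by (auto simp: h_def)
    qed
    have sub: "strict_mono_on {..<t} (h \<circ> k)" "(h \<circ> k) ` {..<t} \<subseteq> {..<m}"
      if "strict_mono k" "\<And>i. i < t \<Longrightarrow> k i < Suc r" for k t
      using that by (auto simp: strict_mono_on_def strict_mono_def h_less h_m)
    have hl: "h \<circ> insert_index l = f"
      by (auto simp: h_def insert_index_def fun_eq_iff)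
    have Suc: "strict_mono Suc" by (simp add: strict_mono_def)
    have E: "0 < minor c (h \<circ> k) g (Suc s)" if "strict_mono k" "\<And>i. i < Suc s \<Longrightarrow> k i < Suc r" for k
      using lower[of "h \<circ> k"] sub[of k "Suc s"] that r by simp
    \<comment> \<open>\<open>h o Suc\<close> starts after \<open>f 0\<close> and keeps the last row;
      \<open>h o id\<close> keeps the first row and stops before \<open>f (r - 1)\<close>. Both have
      smaller dispersion.\<close>
    have "0 < minor c (h \<circ> Suc) g r"
      using h_less[of 0 1] h_less[of 1 r] l r
      by (intro less.hyps sub Suc) (auto simp: h_def split: if_splits)
    moreover have "0 < minor c (h \<circ> id) g r"
      using h_less[of "r - 1" r] h_less[of 0 "r - 1"] l r
      by (intro less.hyps sub) (auto simp: h_def strict_mono_def split: if_splits)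
    moreover have "0 < minor c (h \<circ> insert_index l) g (Suc s)"
      by (intro E strict_mono_insert_index) (auto simp: r insert_index_def)
    moreover have "0 < minor c (h \<circ> (Suc \<circ> insert_index (l - 1))) g (Suc s)"
      by (rule E) (auto simp: r strict_mono_def insert_index_def)
    \<comment> \<open>The right side of the three-term relation is positive, and the factor beside
      the minor of \<open>f\<close> is a positive minor of order \<open>r - 1\<close>, so it
      cancels.\<close>
    ultimately have "0 < minor c f g r * minor c (h \<circ> Suc) g (Suc s)"
      using minor_three_term[of l s c h g] l unfolding r hl by (simp add: o_assoc add_pos_pos)
    moreover have "0 < minor c (h \<circ> Suc) g (Suc s)"
      by (intro E Suc) (auto simp: r)
    ultimately show ?thesis
      by (simp add: zero_less_mult_iff)
  qed
qed

text \<open>Induction on the order, with the dispersion argument used twice: on the rows for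
  consecutive columns, then, after transposing, on the columns for arbitrary rows. The minors one
  order lower come from the induction hypothesis.\<close>

lemma fekete:
  fixes c :: "nat \<Rightarrow> nat \<Rightarrow> 'a::linordered_idom"
  assumes "\<And>r a b. r \<in> {1..k} \<Longrightarrow> a + r \<le> m \<Longrightarrow> b + r \<le> n \<Longrightarrow> 0 < minor c (\<lambda>i. a + i) (\<lambda>j. b + j) r"
    and "r \<le> k"
    and "strict_mono_on {..<r} f" "f ` {..<r} \<subseteq> {..<m}"
    and "strict_mono_on {..<r} g" "g ` {..<r} \<subseteq> {..<n}"
  shows "0 < minor c f g r"
  using assms(2-)
proof (induction r arbitrary: f g)
  case (Suc r)
  have consec: "0 < minor c f (\<lambda>j. b + j) (Suc r)"
    if "strict_mono_on {..<Suc r} f" "f ` {..<Suc r} \<subseteq> {..<m}" "b + Suc r \<le> n" for f b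
  proof (rule minor_pos_of_consecutive_rows[of "Suc r" m])
    show "0 < minor c f' (\<lambda>j. b + j) (Suc r - 1)"
      if "strict_mono_on {..<Suc r - 1} f'" "f' ` {..<Suc r - 1} \<subseteq> {..<m}" for f'
      using Suc.IH[of f' "\<lambda>j. b + j"] Suc.prems(1) that \<open>b + Suc r \<le> n\<close>
      by (simp add: strict_mono_on_def image_subset_iff)
  qed (use that assms(1) Suc.prems(1) in auto)
  have "0 < minor (\<lambda>i j. c j i) g f (Suc r)"
  proof (rule minor_pos_of_consecutive_rows[of "Suc r" n])
    show "0 < minor (\<lambda>i j. c j i) g' f (Suc r - 1)"
      if "strict_mono_on {..<Suc r - 1} g'" "g' ` {..<Suc r - 1} \<subseteq> {..<n}" for g'
      unfolding minor_transpose[of c]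
      using Suc.IH[of f g'] Suc.prems that by (simp add: strict_mono_on_def image_subset_iff)
  qed (use Suc.prems consec in \<open>auto simp: minor_transpose[of c]\<close>)
  then show ?case by (simp add: minor_transpose[of c])
qed simp

section \<open>Uniqueness for P-matrices\<close>

text \<open>Expansion along a unit row deletes that row and its column, so repeated expansion ends
  in a principal minor of \<open>c\<close> on indices in \<open>S\<close>.\<close>

lemma minor_unit_rows_pos:
  fixes c :: "nat \<Rightarrow> nat \<Rightarrow> 'a::linordered_idom"
  assumes pos: "\<And>s f. strict_mono_on {..<s} f \<Longrightarrow> f ` {..<s} \<subseteq> {..<n} \<Longrightarrow> 0 < minor c f f s"
    and f: "strict_mono_on {..<r} f" "f ` {..<r} \<subseteq> {..<n}"
  shows "0 < minor (\<lambda>i j. if i \<in> S then c i j else if i = j then 1 else 0) f f r"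
    (is "0 < minor ?c f f r")
  using f
proof (induction r arbitrary: f)
  case (Suc r)
  show ?case
  proof (cases "\<exists>a<Suc r. f a \<notin> S")
    case False
    then have "minor ?c f f (Suc r) = minor c f f (Suc r)"
      by (intro minor_cong) auto
    with pos Suc.prems show ?thesis by metis
  next
    case True
    then obtain a where a: "a < Suc r" "f a \<notin> S" by blast
    \<comment> \<open>Injectivity leaves row \<open>a\<close> only its diagonal 1, with sign
      \<open>(-1) ^ (a + a)\<close>.\<close>
    have "f a \<noteq> f j" if "j < Suc r" "j \<noteq> a" for j
      using inj_onD[OF strict_mono_on_imp_inj_on[OF Suc.prems(1)], of a j] a that by auto
    then have "minor ?c f f (Suc r) = minor ?c (f \<circ> insert_index a) (f \<circ> insert_index a) r"
      using a by (subst minor_laplace_row[of a]) (auto simp: sum.remove[of _ a] simp del: sum.lessThan_Suc)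
    moreover have "strict_mono_on {..<r} (f \<circ> insert_index a)"
      using Suc.prems(1) strict_mono_insert_index[of a]
      by (auto simp: strict_mono_on_def strict_mono_def insert_index_less)
    moreover have "(f \<circ> insert_index a) ` {..<r} \<subseteq> {..<n}"
      using Suc.prems(2) by (auto simp: image_subset_iff insert_index_less)
    ultimately show ?thesis by (simp only: Suc.IH)
  qed
qed simp

text \<open>Linearity in each row of \<open>T\<close> splits the determinant into those of the
  preceding lemma with nonnegative weights. \<open>S\<close> collects the rows taken from
  \<open>c\<close>, so it varies in the induction.\<close>

lemma minor_mixed_rows_pos:
  fixes c :: "nat \<Rightarrow> nat \<Rightarrow> 'a::linordered_idom"
  assumes pos: "\<And>s f. strict_mono_on {..<s} f \<Longrightarrow> f ` {..<s} \<subseteq> {..<n} \<Longrightarrow> 0 < minor c f f s"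
    and coeff: "\<And>i. i < n \<Longrightarrow> 0 \<le> \<alpha> i \<and> 0 \<le> \<delta> i \<and> 0 < \<alpha> i + \<delta> i"
    and T: "finite T" "T \<subseteq> {..<n}"
  shows "0 < minor (\<lambda>i j. if i \<in> T then \<alpha> i * c i j + \<delta> i * (if i = j then 1 else 0)
                     else if i \<in> S then c i j else if i = j then 1 else 0) id id n"
  using T
proof (induction T arbitrary: S)
  case empty
  show ?case using minor_unit_rows_pos[where n = n and r = n and f = id and S = S, OF pos]
    by (simp add: strict_mono_on_def id_def)
next
  case (insert t T)
  let ?c = "\<lambda>T S i j. if i \<in> T then \<alpha> i * c i j + \<delta> i * (if i = j then 1 else 0)
                     else if i \<in> S then c i j else if i = j then 1 else 0"
  have "minor (?c (insert t T) S) id id n =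
      \<alpha> t * minor (?c T (insert t S)) id id n + \<delta> t * minor (?c T (S - {t})) id id n"
    by (rule minor_row_linear[of t]) (use insert.prems insert.hyps in auto)
  moreover have "0 < minor (?c T (insert t S)) id id n" "0 < minor (?c T (S - {t})) id id n"
    by (rule insert.IH, use insert.prems in simp)+
  moreover have "0 \<le> \<alpha> t" "0 \<le> \<delta> t" "0 < \<alpha> t \<or> 0 < \<delta> t"
    using coeff[of t] insert.prems by (auto intro: ccontr)
  ultimately show ?case
    by (auto simp: id_def add_pos_nonneg add_nonneg_pos)
qed

text \<open>A sign-reversed \<open>u\<close> lies in the kernel of the matrix with rows \<open>M\<^sub>i - ((M u)\<^sub>i / u\<^sub>i) e\<^sub>i\<close>,
  or \<open>e\<^sub>i\<close> where \<open>u\<^sub>i = 0\<close>, whose determinant is positive.\<close>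

lemma P_matrix_no_sign_reversal:
  fixes M :: "'a::linordered_field mat"
  assumes M: "M \<in> carrier_mat n n" and u: "u \<in> carrier_vec n"
    and pos: "\<And>s f. strict_mono_on {..<s} f \<Longrightarrow> f ` {..<s} \<subseteq> {..<n} \<Longrightarrow>
      0 < minor (\<lambda>i j. M $$ (i, j)) f f s"
    and rev: "\<And>i. i < n \<Longrightarrow> u $ i * (M *\<^sub>v u) $ i \<le> 0"
  shows "u = 0\<^sub>v n"
proof (rule ccontr)
  assume "u \<noteq> 0\<^sub>v n"
  define \<alpha> where "\<alpha> i = (if u $ i = 0 then 0 else 1 :: 'a)" for i
  define \<delta> where "\<delta> i = (if u $ i = 0 then 1 else - ((M *\<^sub>v u) $ i / u $ i))" for i
  define N where "N = mat n n (\<lambda>(i, j). \<alpha> i * M $$ (i, j) + \<delta> i * (if i = j then 1 else 0))"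
  \<comment> \<open>Where \<open>u $ i\<close> is nonzero, sign reversal says exactly that \<delta>
    is nonnegative.\<close>
  have "0 \<le> \<alpha> i \<and> 0 \<le> \<delta> i \<and> 0 < \<alpha> i + \<delta> i" if "i < n" for i
    using rev[OF that]
    by (auto simp: \<alpha>_def \<delta>_def divide_le_0_iff mult_le_0_iff intro: add_pos_nonneg)
  then have "0 < minor (\<lambda>i j. if i \<in> {..<n} then \<alpha> i * M $$ (i, j) + \<delta> i * (if i = j then 1 else 0)
      else if i \<in> {} then M $$ (i, j) else if i = j then 1 else 0) id id n"
    by (intro minor_mixed_rows_pos pos) auto
  also have "\<dots> = det N"
    unfolding minor_def N_def by (rule arg_cong[of _ _ det], rule cong_mat) auto
  finally have "det N \<noteq> 0" by simp
  moreover have "N *\<^sub>v u = 0\<^sub>v n"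
  proof (rule eq_vecI)
    fix i assume "i < dim_vec (0\<^sub>v n :: 'a vec)"
    then have i: "i < n" by simp
    have "(N *\<^sub>v u) $ i = (\<Sum>j<n. \<alpha> i * (M $$ (i, j) * u $ j) + (if i = j then \<delta> i * u $ j else 0))"
      using i u by (auto simp: N_def scalar_prod_def lessThan_atLeast0 algebra_simps intro!: sum.cong)
    also have "\<dots> = \<alpha> i * (M *\<^sub>v u) $ i + \<delta> i * u $ i"
      using i u M by (simp add: sum.distrib sum_distrib_left scalar_prod_def lessThan_atLeast0)
    finally show "(N *\<^sub>v u) $ i = 0\<^sub>v n $ i"
      using i by (simp add: \<alpha>_def \<delta>_def)
  qed (simp add: N_def)
  moreover have "N \<in> carrier_mat n n" by (simp add: N_def)
  ultimately show False
    using det_0_iff_vec_prod_zero[of N n] u \<open>u \<noteq> 0\<^sub>v n\<close> by blast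
qed

text \<open>For feasible \<open>x\<close> the inner product is a sum of nonnegative terms, so it
  vanishes only if each term does.\<close>

lemma LCP_solutions_iff:
  assumes "M \<in> carrier_mat n n" "q \<in> carrier_vec n"
  shows "x \<in> LCP_solutions M q \<longleftrightarrow> x \<in> carrier_vec n \<and>
    (\<forall>i<n. 0 \<le> x $ i \<and> 0 \<le> (M *\<^sub>v x) $ i + q $ i \<and> x $ i * ((M *\<^sub>v x) $ i + q $ i) = 0)"
proof -
  have compl: "x \<bullet> (M *\<^sub>v x + q) = 0 \<longleftrightarrow> (\<forall>i<n. x $ i * ((M *\<^sub>v x) $ i + q $ i) = 0)"
    if "\<forall>i<n. 0 \<le> x $ i" "\<forall>i<n. 0 \<le> (M *\<^sub>v x) $ i + q $ i"
  proof -
    have "x \<bullet> (M *\<^sub>v x + q) = (\<Sum>i<n. x $ i * ((M *\<^sub>v x) $ i + q $ i))"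
      using assms unfolding scalar_prod_def[of x] lessThan_atLeast0
      by (intro sum.cong) (simp_all del: index_mult_mat_vec)
    also have "\<dots> = 0 \<longleftrightarrow> (\<forall>i\<in>{..<n}. x $ i * ((M *\<^sub>v x) $ i + q $ i) = 0)"
      by (rule sum_nonneg_eq_0_iff) (use that in auto)
    finally show ?thesis by (simp add: Ball_def)
  qed
  have "0\<^sub>v n \<le> x \<longleftrightarrow> (\<forall>i<n. 0 \<le> x $ i)" if "x \<in> carrier_vec n"
    using that by (auto simp: less_eq_vec_def)
  moreover have "0\<^sub>v n \<le> M *\<^sub>v x + q \<longleftrightarrow> (\<forall>i<n. 0 \<le> (M *\<^sub>v x) $ i + q $ i)"
    using assms by (simp add: less_eq_vec_def del: index_mult_mat_vec)
  moreover have "x \<in> LCP_solutions M q \<longleftrightarrow>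
      x \<in> carrier_vec n \<and> 0\<^sub>v n \<le> x \<and> 0\<^sub>v n \<le> M *\<^sub>v x + q \<and> x \<bullet> (M *\<^sub>v x + q) = 0"
    using assms(1) by (simp add: LCP_solutions_def)
  ultimately show ?thesis using compl by blast
qed

text \<open>With residuals \<open>v\<close>, \<open>w\<close> of the solutions \<open>x\<close>,
  \<open>z\<close>, complementarity turns the coordinatewise product of \<open>x - z\<close> and
  \<open>M (x - z)\<close> into \<open>- x w - z v\<close>, which is nonpositive; so
  \<open>x - z\<close> is sign-reversed.\<close>

lemma P_matrix_LCP_unique:
  assumes M: "M \<in> carrier_mat n n" and q: "q \<in> carrier_vec n"
    and pos: "\<And>s f. strict_mono_on {..<s} f \<Longrightarrow> f ` {..<s} \<subseteq> {..<n} \<Longrightarrow>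
      0 < minor (\<lambda>i j. M $$ (i, j)) f f s"
    and x: "x \<in> LCP_solutions M q" and z: "z \<in> LCP_solutions M q"
  shows "x = z"
proof -
  note xs = x[unfolded LCP_solutions_iff[OF M q]] and zs = z[unfolded LCP_solutions_iff[OF M q]]
  have "x - z = 0\<^sub>v n"
  proof (rule P_matrix_no_sign_reversal[OF M _ pos])
    show "x - z \<in> carrier_vec n" using xs zs by auto
    fix i assume i: "i < n"
    define v w where "v = (M *\<^sub>v x) $ i + q $ i" and "w = (M *\<^sub>v z) $ i + q $ i"
    have dim: "x \<in> carrier_vec n" "z \<in> carrier_vec n" "dim_vec z = n"
      using xs zs by auto
    have "(x - z) $ i * (M *\<^sub>v (x - z)) $ i = (x $ i - z $ i) * (v - w)"
      using i M dim by (simp add: mult_minus_distrib_mat_vec[of M n n] v_def w_def del: index_mult_mat_vec)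
    also have "\<dots> = x $ i * v + z $ i * w - x $ i * w - z $ i * v"
      by (simp add: algebra_simps)
    also have "\<dots> \<le> 0"
    proof -
      have "x $ i * v = 0" "z $ i * w = 0" "0 \<le> x $ i * w" "0 \<le> z $ i * v"
        using xs zs i by (auto simp: v_def w_def)
      then show ?thesis by linarith
    qed
    finally show "(x - z) $ i * (M *\<^sub>v (x - z)) $ i \<le> 0" .
  qed
  then have "x $ i - z $ i = 0" if "i < n" for i
    using that xs zs by (metis carrier_vecD index_minus_vec(1) index_zero_vec(1))
  with xs zs show ?thesis by (intro eq_vecI) auto
qed

section \<open>The test vectors\<close>

lemma insert_index_0: "insert_index 0 = Suc"
  by (auto simp: insert_index_def)

lemma x_vec_index:
  assumes "B \<in> carrier_mat (Suc n) (Suc n)" "j < Suc n"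
  shows "x_vec B $ j = (if even j then minor (\<lambda>i j. B $$ (i, j)) Suc (insert_index j) n else 0)"
proof -
  have "mat_delete B 0 j = mat n n (\<lambda>(i, j'). B $$ (Suc i, insert_index j j'))"
    using assms by (auto simp: mat_delete_def insert_index_def)
  with assms show ?thesis by (simp add: x_vec_def minor_def)
qed

lemma x_vec_carrier: "B \<in> carrier_mat n n \<Longrightarrow> x_vec B \<in> carrier_vec n"
  by (simp add: x_vec_def)

lemma q_vec_carrier: "B \<in> carrier_mat n n \<Longrightarrow> q_vec B \<in> carrier_vec n"
  by (auto simp: q_vec_def intro!: carrier_vecI)

lemma LCP_solutions_of_minors_pos:
  assumes B: "B \<in> carrier_mat (Suc n) (Suc n)"
    and pos: "\<And>s f g. strict_mono_on {..<s} f \<Longrightarrow> f ` {..<s} \<subseteq> {..<Suc n} \<Longrightarrow>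
      strict_mono_on {..<s} g \<Longrightarrow> g ` {..<s} \<subseteq> {..<Suc n} \<Longrightarrow> 0 < minor (\<lambda>i j. B $$ (i, j)) f g s"
  shows "LCP_solutions B (q_vec B) = {x_vec B}"
proof -
  have "0 < minor (\<lambda>i j. B $$ (i, j)) Suc (insert_index j) n" for j
    using strict_mono_insert_index[of j]
    by (intro pos) (auto simp: insert_index_less strict_mono_on_def strict_mono_def)
  then have "0 \<le> x_vec B $ j" if "j < Suc n" for j
    by (simp add: x_vec_index[OF B that] less_imp_le)
  \<comment> \<open>The residual is zero by the choice of \<open>q_vec\<close>, so only
    nonnegativity of \<open>x_vec B\<close> matters.\<close>
  then have "x_vec B \<in> LCP_solutions B (q_vec B)"
    unfolding LCP_solutions_iff[OF B q_vec_carrier[OF B]] using B by (auto simp: x_vec_carrier q_vec_def)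
  with P_matrix_LCP_unique[OF B q_vec_carrier[OF B] pos] show ?thesis by blast
qed

text \<open>If the determinant were not positive, the complementary half \<open>(0, B\<^sup>1\<^sup>2, 0, B\<^sup>1\<^sup>4, \<dots>)\<close> of the
  first row of minors would be a second solution, since \<open>B\<close> sends the alternating vector
  \<open>(B\<^sup>1\<^sup>1, - B\<^sup>1\<^sup>2, B\<^sup>1\<^sup>3, \<dots>)\<close> to \<open>(det B, 0, \<dots>, 0)\<close>.\<close>

lemma det_pos_of_LCP_solutions:
  assumes B: "B \<in> carrier_mat (Suc n) (Suc n)"
    and pos: "\<And>j. j < Suc n \<Longrightarrow> 0 < minor (\<lambda>i j. B $$ (i, j)) Suc (insert_index j) n"
    and sol: "LCP_solutions B (q_vec B) = {x_vec B}"
  shows "0 < minor (\<lambda>i j. B $$ (i, j)) id id (Suc n)" (is "0 < ?d")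
proof (rule ccontr)
  assume d: "\<not> 0 < ?d"
  define \<mu> where "\<mu> j = minor (\<lambda>i j. B $$ (i, j)) Suc (insert_index j) n" for j
  define z where "z = vec (Suc n) (\<lambda>j. if even j then 0 else \<mu> j)"
  \<comment> \<open>Row 0 gives the Laplace expansion of the determinant; every other row gives the
    expansion of one with a repeated row.\<close>
  have alt: "(\<Sum>j<Suc n. B $$ (i, j) * ((-1) ^ j * \<mu> j)) = (if i = 0 then ?d else 0)" if "i < Suc n" for i
  proof (cases i)
    case 0
    then show ?thesis
      by (simp add: minor_laplace_row[of 0 n _ id] insert_index_0 \<mu>_def del: sum.lessThan_Suc)
  next
    case (Suc i')
    then show ?thesis
      using minor_kernel_row[of i' n "\<lambda>i j. B $$ (i, j)" Suc id] that by (simp add: \<mu>_def del: sum.lessThan_Suc)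
  qed
  \<comment> \<open>\<open>z - x_vec B\<close> is minus the alternating vector of minors.\<close>
  have val: "(B *\<^sub>v z) $ i + q_vec B $ i = (if i = 0 then - ?d else 0)" if i: "i < Suc n" for i
  proof -
    have "(B *\<^sub>v z) $ i + q_vec B $ i = (\<Sum>j<Suc n. B $$ (i, j) * (z $ j - x_vec B $ j))"
      using B i x_vec_carrier[OF B]
      by (simp add: q_vec_def scalar_prod_def z_def lessThan_atLeast0 sum_subtractf[symmetric] right_diff_distrib
          del: sum.op_ivl_Suc)
    also have "\<dots> = (\<Sum>j<Suc n. - (B $$ (i, j) * ((-1) ^ j * \<mu> j)))"
      by (rule sum.cong) (auto simp: z_def x_vec_index[OF B] \<mu>_def)
    finally show ?thesis
      using alt[OF i] by (simp add: sum_negf del: sum.lessThan_Suc)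
  qed
  \<comment> \<open>The residual is supported at index 0, where \<open>z\<close> vanishes;
    \<open>d\<close> makes it nonnegative.\<close>
  have "z \<in> LCP_solutions B (q_vec B)"
    using d pos val by (auto simp: LCP_solutions_iff[OF B q_vec_carrier[OF B]] z_def[symmetric])
      (auto simp: z_def \<mu>_def less_imp_le)
  then have "x_vec B = z" using sol by simp
  \<comment> \<open>Index 0 is even, so \<open>x_vec B\<close> carries a positive minor
    there.\<close>
  then have "x_vec B $ 0 = 0" by (simp add: z_def)
  with pos[of 0] show False by (simp add: x_vec_index[OF B])
qed

section \<open>Submatrices\<close>

text \<open>Exactly \<open>i\<close> elements of the image lie below \<open>f i\<close>, and
  \<open>pick\<close> selects by this rank.\<close>

lemma pick_image:
  assumes "strict_mono_on {..<r} f" "i < r"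
  shows "pick (f ` {..<r}) i = f i"
proof -
  have less_iff: "f a < f i \<longleftrightarrow> a < i" if "a < r" for a
    using strict_mono_on_less[OF assms(1), of a i] that assms(2) by simp
  have "{a \<in> f ` {..<r}. a < f i} = f ` {..<i}"
    using assms(2) by (auto simp: less_iff)
  moreover have "inj_on f {..<i}"
    by (rule inj_on_subset[OF strict_mono_on_imp_inj_on[OF assms(1)]]) (use assms(2) in auto)
  ultimately have "card {a \<in> f ` {..<r}. a < f i} = i"
    by (simp add: card_image)
  with pick_card_in_set[of "f i" "f ` {..<r}"] assms(2) show ?thesis by simp
qed

lemma submatrix_eq_mat:
  assumes "A \<in> carrier_mat m n" "I \<subseteq> {..<m}" "J \<subseteq> {..<n}" "card I = r" "card J = s"
  shows "submatrix A I J = mat r s (\<lambda>(i, j). A $$ (pick I i, pick J j))"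
proof -
  have "{i. i < dim_row A \<and> i \<in> I} = I" "{j. j < dim_col A \<and> j \<in> J} = J"
    using assms by auto
  with assms show ?thesis by (simp add: submatrix_def)
qed

text \<open>A strictly increasing function gives its image as index set, and a set gives its
  enumeration \<open>pick\<close>. This brings \<open>TP\<close> into the form that Fekete's
  criterion delivers.\<close>

lemma TP_iff_minor:
  assumes A: "A \<in> carrier_mat m n"
  shows "TP k A \<longleftrightarrow> (\<forall>r\<in>{1..k}. \<forall>f g.
    strict_mono_on {..<r} f \<longrightarrow> f ` {..<r} \<subseteq> {..<m} \<longrightarrow>
    strict_mono_on {..<r} g \<longrightarrow> g ` {..<r} \<subseteq> {..<n} \<longrightarrow> 0 < minor (\<lambda>i j. A $$ (i, j)) f g r)"
    (is "_ \<longleftrightarrow> ?R")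
proof
  assume tp: "TP k A"
  show ?R
  proof (intro ballI allI impI)
    fix r f g
    assume r: "r \<in> {1..k}" and f: "strict_mono_on {..<r} f" "f ` {..<r} \<subseteq> {..<m}"
      and g: "strict_mono_on {..<r} g" "g ` {..<r} \<subseteq> {..<n}"
    have c: "card (f ` {..<r}) = r" "card (g ` {..<r}) = r"
      using f g by (simp_all add: card_image strict_mono_on_imp_inj_on)
    then have "0 < det (submatrix A (f ` {..<r}) (g ` {..<r}))"
      using tp r f g A unfolding TP_def by (metis atLeastAtMost_iff carrier_matD)
    also have "submatrix A (f ` {..<r}) (g ` {..<r}) = mat r r (\<lambda>(i, j). A $$ (f i, g j))"
      unfolding submatrix_eq_mat[OF A f(2) g(2) c]
      by (rule cong_mat) (simp_all add: pick_image[OF f(1)] pick_image[OF g(1)])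
    finally show "0 < minor (\<lambda>i j. A $$ (i, j)) f g r" by (simp add: minor_def)
  qed
next
  assume R: ?R
  have pick: "strict_mono_on {..<r} (pick I)" "pick I ` {..<r} \<subseteq> I" if "card I = r" for I r
    using that by (auto simp: strict_mono_on_def pick_mono_le pick_in_set_le)
  show "TP k A"
    unfolding TP_def
  proof (intro allI impI, elim conjE)
    fix r I J
    assume r: "1 \<le> r" "r \<le> k" and I: "I \<subseteq> {..<dim_row A}" "card I = r"
      and J: "J \<subseteq> {..<dim_col A}" "card J = r"
    have "0 < minor (\<lambda>i j. A $$ (i, j)) (pick I) (pick J) r"
      using R[rule_format, of r "pick I" "pick J"] r pick[OF I(2)] pick[OF J(2)] I(1) J(1) A by auto
    then show "0 < det (submatrix A I J)"
      using submatrix_eq_mat[of A m n I J r r] I J A by (simp add: minor_def)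
  qed
qed

lemma pick_atLeastLessThan: "i < r \<Longrightarrow> pick {a..<a + r} i = a + i"
proof -
  assume "i < r"
  moreover have "(+) a ` {..<r} = {a..<a + r}"
    by (simp add: lessThan_atLeast0 add.commute)
  ultimately show ?thesis
    using pick_image[of r "(+) a" i] by (simp add: strict_mono_on_def)
qed

lemma contiguous_submatrix_iff:
  assumes A: "A \<in> carrier_mat m n" and r: "1 \<le> r"
  shows "contiguous_submatrix A r B \<longleftrightarrow>
    (\<exists>a b. a + r \<le> m \<and> b + r \<le> n \<and> B = mat r r (\<lambda>(i, j). A $$ (a + i, b + j)))"
proof -
  have block: "submatrix A {a..<a + r} {b..<b + r} = mat r r (\<lambda>(i, j). A $$ (a + i, b + j))"
    if "a + r \<le> m" "b + r \<le> n" for a b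
  proof -
    have "{a..<a + r} \<subseteq> {..<m}" "{b..<b + r} \<subseteq> {..<n}" using that by auto
    then show ?thesis
      using submatrix_eq_mat[OF A, of "{a..<a + r}" "{b..<b + r}" r r]
      by (auto simp: pick_atLeastLessThan)
  qed
  \<comment> \<open>Since \<open>r\<close> is at least 1 the interval is nonempty: its cardinality
    fixes the endpoint, and its last element \<open>a + r - 1\<close> yields the bound.\<close>
  have interval: "\<exists>a. I = {a..<a + r} \<and> a + r \<le> N"
    if "consecutive I" "card I = r" "I \<subseteq> {..<N}" for I N
  proof -
    obtain a b where I: "I = {a..<b}" using \<open>consecutive I\<close> by (auto simp: consecutive_def)
    then have "b = a + r" using that r by auto
    moreover have "a + r - 1 \<in> I" using I calculation r by auto
    ultimately show ?thesis using that(3) I r by force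
  qed
  show ?thesis
  proof
    assume "contiguous_submatrix A r B"
    then obtain I J where "I \<subseteq> {..<m}" "J \<subseteq> {..<n}" "consecutive I" "consecutive J"
        "card I = r" "card J = r" "B = submatrix A I J"
      using A by (auto simp: contiguous_submatrix_def)
    with interval[of I m] interval[of J n] block show
      "\<exists>a b. a + r \<le> m \<and> b + r \<le> n \<and> B = mat r r (\<lambda>(i, j). A $$ (a + i, b + j))"
      by blast
  next
    assume "\<exists>a b. a + r \<le> m \<and> b + r \<le> n \<and> B = mat r r (\<lambda>(i, j). A $$ (a + i, b + j))"
    then obtain a b where ab: "a + r \<le> m" "b + r \<le> n" "B = mat r r (\<lambda>(i, j). A $$ (a + i, b + j))"
      by blast
    show "contiguous_submatrix A r B"
      unfolding contiguous_submatrix_def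
      by (rule exI[of _ "{a..<a + r}"], rule exI[of _ "{b..<b + r}"])
        (use ab block A in \<open>auto simp: consecutive_def\<close>)
  qed
qed

section \<open>Minors of blocks inside the whole matrix, and the equivalence\<close>

lemma minor_block:
  assumes "f ` {..<s} \<subseteq> {..<r}" "g ` {..<s} \<subseteq> {..<r}"
  shows "minor (\<lambda>i j. mat r r (\<lambda>(i, j). c (a + i) (b + j)) $$ (i, j)) f g s =
    minor c (\<lambda>i. a + f i) (\<lambda>j. b + g j) s"
  by (rule minor_cong) (use assms in \<open>auto simp: image_subset_iff\<close>)

theorem theorem2:
  fixes A :: "real mat" and m n k :: nat
  assumes "1 \<le> k" and "k \<le> m" and "k \<le> n"
    and "A \<in> carrier_mat m n"
  shows "TP k A \<longleftrightarrow>
    (\<forall>r\<in>{1..k}. \<forall>B. contiguous_submatrix A r B \<longrightarrow>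
       LCP_solutions B (q_vec B) = {x_vec B})"
proof
  let ?c = "\<lambda>i j. A $$ (i, j)"
  note A = \<open>A \<in> carrier_mat m n\<close>
  have shift: "strict_mono_on {..<s} (\<lambda>i. a + f i) \<and> (\<lambda>i. a + f i) ` {..<s} \<subseteq> {..<N}"
    if "strict_mono_on {..<s} f" "f ` {..<s} \<subseteq> {..<r}" "a + r \<le> N" for a r s N :: nat and f
  proof -
    have "a + f i < N" if "i < s" for i
    proof -
      have "f i < r" using \<open>f ` {..<s} \<subseteq> {..<r}\<close> that by auto
      with \<open>a + r \<le> N\<close> show ?thesis by simp
    qed
    with that(1) show ?thesis by (auto simp: strict_mono_on_def)
  qed
  {
    assume tp: "TP k A"
    show "\<forall>r\<in>{1..k}. \<forall>B. contiguous_submatrix A r B \<longrightarrow> LCP_solutions B (q_vec B) = {x_vec B}"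
    proof (intro ballI allI impI)
      fix r B assume r: "r \<in> {1..k}" and "contiguous_submatrix A r B"
      then obtain a b where ab: "a + r \<le> m" "b + r \<le> n"
        and B: "B = mat r r (\<lambda>(i, j). ?c (a + i) (b + j))"
        using contiguous_submatrix_iff[OF A, of r B] by auto
      obtain t where t: "r = Suc t" using r by (cases r) auto
      show "LCP_solutions B (q_vec B) = {x_vec B}"
      proof (rule LCP_solutions_of_minors_pos[of B t])
        show "B \<in> carrier_mat (Suc t) (Suc t)" by (simp add: B t)
        fix s :: nat and f g :: "nat \<Rightarrow> nat"
        assume f: "strict_mono_on {..<s} f" "f ` {..<s} \<subseteq> {..<Suc t}"
          and g: "strict_mono_on {..<s} g" "g ` {..<s} \<subseteq> {..<Suc t}"
        have "s \<le> r"
          using card_inj_on_le[of f "{..<s}" "{..<r}"] strict_mono_on_imp_inj_on[OF f(1)] f(2) t by simp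
        \<comment> \<open>Order 0 is split off because \<open>TP\<close> starts at order 1; the
          empty minor is 1.\<close>
        then have "0 < minor ?c (\<lambda>i. a + f i) (\<lambda>j. b + g j) s"
          using tp[unfolded TP_iff_minor[OF A], rule_format, of s] r f g ab
            shift[of s f r a m] shift[of s g r b n]
          by (cases "s = 0") (simp_all add: t)
        then show "0 < minor (\<lambda>i j. B $$ (i, j)) f g s"
          using minor_block[of f s r g ?c a b] f g by (simp add: B t)
      qed
    qed
  }
  assume lcp: "\<forall>r\<in>{1..k}. \<forall>B. contiguous_submatrix A r B \<longrightarrow> LCP_solutions B (q_vec B) = {x_vec B}"
  \<comment> \<open>Strong induction on the order: contiguous minors of smaller order are positive,
    Fekete's criterion extends this to all minors of order \<open>t\<close>, hence to the first-row
    minors of \<open>B\<close>, and uniqueness of the solution then forces a positive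
    determinant.\<close>
  have contiguous: "0 < minor ?c (\<lambda>i. a + i) (\<lambda>j. b + j) r"
    if "r \<in> {1..k}" "a + r \<le> m" "b + r \<le> n" for r a b
    using that
  proof (induction r arbitrary: a b rule: less_induct)
    case (less r)
    then obtain t where t: "r = Suc t" by (cases r) auto
    define B where "B = mat r r (\<lambda>(i, j). ?c (a + i) (b + j))"
    have "0 < minor (\<lambda>i j. B $$ (i, j)) id id (Suc t)"
    proof (rule det_pos_of_LCP_solutions)
      show "B \<in> carrier_mat (Suc t) (Suc t)" by (simp add: B_def t)
      have "contiguous_submatrix A r B"
        using less.prems contiguous_submatrix_iff[OF A, of r B] by (auto simp: B_def)
      with lcp less.prems show "LCP_solutions B (q_vec B) = {x_vec B}" by blast
      fix j assume "j < Suc t"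
      have Suc: "strict_mono_on {..<t} Suc" "Suc ` {..<t} \<subseteq> {..<r}"
        by (auto simp: strict_mono_on_def t)
      have ins: "strict_mono_on {..<t} (insert_index j)" "insert_index j ` {..<t} \<subseteq> {..<r}"
        using strict_mono_insert_index[of j]
        by (auto simp: strict_mono_on_def strict_mono_def insert_index_less t)
      have "0 < minor ?c (\<lambda>i. a + Suc i) (\<lambda>i. b + insert_index j i) t"
      proof (rule fekete[of t m n])
        show "0 < minor ?c (\<lambda>i. a + i) (\<lambda>j. b + j) r'"
          if "r' \<in> {1..t}" "a + r' \<le> m" "b + r' \<le> n" for r' a b
          using less.IH[of r' a b] less.prems(1) that t by simp
      qed (use shift[OF Suc less.prems(2)] shift[OF ins less.prems(3)] in simp_all)
      then show "0 < minor (\<lambda>i j. B $$ (i, j)) Suc (insert_index j) t"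
        by (simp only: B_def minor_block[OF Suc(2) ins(2), of ?c])
    qed
    then show ?case
      using minor_block[of id r r id ?c a b] by (simp add: B_def t)
  qed
  show "TP k A"
    unfolding TP_iff_minor[OF A] using fekete[of k m n ?c, OF contiguous] by simp
qed

end
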